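(* Let $M\ge 2$, $b\ge 1$, $d_{\max}\ge 1$ be integers, let $\mu_P,\mu_{Nc},\mu_{Ns}>0$, let $D$ be a probability mass function on $\{1,\dots,d_{\max}\}$, and put $U=\min(M-1,d_{\max})-1$. Suppose that $\lambda>0$ and nonnegative reals $\alpha_k$ ($0\le k\le U$), with $\alpha_{U+1}=0$, and positive reals $\alpha_{Pc}$, $\alpha^-_{Ps_i}$ ($1\le i\le b-1$), $\alpha^+_{Ns_i}$ ($1\le i\le b$), $\rho_P,\rho_{Nc},\rho_{Ns}$ satisfy the traffic equations of the fully sharded blockchain with multi-destination transactions: $$\alpha_k=\lambda\,\delta[k]+(M-1)R^k+\alpha_{k+1}\qquad(0\le k\le U),$$ $$R^k=\frac{\rho_{Ns}\,\mu_{Ns}}{M-1}\sum_{d=k+1}^{d_{\max}}\frac{\lambda\,D[d]}{\sum_{j=0}^{U}\alpha_j}\cdot\frac{N(M,d,k+1)}{M^d},\qquad N(M,d,i)=\frac{(M-1)!}{(M-i-1)!}\genfrac\{\}{0pt}{}{d+1}{i+1},$$ $$\alpha_{Pc}=\rho_{Nc}\,\mu_{Nc},\qquad \alpha^-_{Ps_i}=\alpha^+_{Ns_{i+1}}\ (1\le i\le b-1),\qquad \alpha^+_{Ns_b}=\rho_P\,\mu_P,\qquad \alpha^+_{Ns_i}=\rho_P\,\alpha^-_{Ps_i}\ (1\le i\le b-1),$$ where $$\rho_P=\frac{\alpha_{Pc}}{\mu_P+\sum_{i=1}^{b-1}\alpha^-_{Ps_i}},\qquad \rho_{Nc}=\frac{\sum_{k=0}^{U}\alpha_k}{\mu_{Nc}},\qquad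 \rho_{Ns}=\frac{\sum_{i=1}^{b}\alpha^+_{Ns_i}}{\mu_{Ns}}.$$ Then, if $\rho_P\ne 1$, $$\lambda=\frac{\rho_P(1-\rho_P^{\,b})}{1-\rho_P}\cdot\frac{\mu_P}{1+\sum_{k=0}^{U}(k+1)\sum_{d=k+1}^{d_{\max}}\genfrac\{\}{0pt}{}{d+1}{k+2}D[d]\,\frac{\prod_{z=1}^{k+1}(M-z)}{M^d}},$$ and if $\rho_P=1$ the same holds with the first factor $\frac{\rho_P(1-\rho_P^b)}{1-\rho_P}$ replaced by $b$. Moreover, denoting by $\lambda_{\max}=\lambda_{\max}(M)$ the value of $\lambda$ at $\rho_P=1$, for fixed $b$, $\mu_P$, $d_{\max}$ and $D$, $$\lim_{M\to\infty}\lambda_{\max}(M)=\frac{b\,\mu_P}{1+E[d]},\qquad E[d]=\sum_{d=1}^{d_{\max}}d\,D[d].$$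
   Context: $\genfrac\{\}{0pt}{}{n}{q}=\frac1{q!}\sum_{p=0}^{q}(-1)^p\binom qp(q-p)^n$ is the Stirling number of the second kind, and $\delta[k]=1$ if $k=0$ and $0$ otherwise. The model is a symmetric queueing network of $M$ identical shards, each with a consensus queue $P$ (block production, service rate $\mu_P$) and a network queue $N$ (service rate $\mu_{Nc}$ for transactions and receipts, class $c$, and $\mu_{Ns}$ for block components, class $s$). A block contains at most $b$ transactions/receipts. $\lambda$ is the rate of newly issued transactions to each shard; each has $d$ destination fields with probability $D[d]$. $\alpha_k$ is the arrival rate to a network queue of the stage-$k$ positive signal $c_k^+$ (stage = number of shards it still has to visit; $c_0^+$ is an ordinary class $c$ customer), and every signal adds a class $c$ customer to the queue it visits. $R^k$ is the rate at which served block components of one network queue produce a stage-$k$ signal aimed at a given other network queue. $\alpha_{Pc}$ is the arrival rate of class $c$ customers to $P$; $\alpha^-_{Ps_i}$ and $\alpha^+_{Ns_i}$ are the arrival rates of the negative signal $s_i^-$ to $P$ and the positive signal $s_i^+$ to $N$; $\rho_P,\rho_{Nc},\rho_{Ns}$ are utilization factors. By symmetry, equations are written for one shard. The network queue is assumed fast enough (both $\mu_{Nc}$ and $\mu_{Ns}$ much larger than $b\mu_P$) that the consensus queue is the bottleneck, so the maximum stable throughput per shard is the value of $\lambda$ at $\rho_P=1$. *)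

theory Defs
  imports "HOL-Probability.Probability_Mass_Function" "HOL-Combinatorics.Stirling"
begin

text \<open>
  Stirling numbers of the second kind are the library constant \<^const>\<open>Stirling\<close>, which is
  defined by recursion; it agrees with the alternating-sum formula.
\<close>

lemma Stirling_alternating_sum:
  "real (Stirling n q) =
     1 / fact q * (\<Sum>p = 0..q. (-1) ^ p * real (q choose p) * real (q - p) ^ n)"
proof -
  define f :: "nat \<Rightarrow> nat \<Rightarrow> real"
    where "f n q = (\<Sum>p\<le>q. (-1) ^ p * real (q choose p) * real (q - p) ^ n)" for n q
  have rec: "f (Suc n) (Suc q) = real (Suc q) * (f n (Suc q) + f n q)" for n q
  proof -
    have absorb: "real (Suc q choose p) * real (Suc q - p) = real (Suc q) * real (q choose p)"
      if "p \<le> Suc q" for p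
    proof (cases "p = Suc q")
      case False
      with that have "p \<le> q" by simp
      have "(Suc q - p) * (Suc q choose p) = Suc q * (q choose p)"
        using binomial_absorb_comp[of "Suc q" p] by simp
      then show ?thesis by (metis mult.commute of_nat_mult)
    qed simp
    have split: "(\<Sum>p\<le>Suc q. g p) = g 0 + (\<Sum>p\<le>q. g (Suc p))" for g :: "nat \<Rightarrow> real"
      by (rule sum.atMost_Suc_shift)
    have "f (Suc n) (Suc q) =
        (\<Sum>p\<le>Suc q. real (Suc q) * ((-1) ^ p * real (q choose p) * real (Suc q - p) ^ n))"
      unfolding f_def
    proof (rule sum.cong[OF refl])
      fix p assume "p \<in> {..Suc q}"
      then have "real (Suc q choose p) * real (Suc q - p) = real (Suc q) * real (q choose p)"
        by (intro absorb) simp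
      then show "(-1) ^ p * real (Suc q choose p) * real (Suc q - p) ^ Suc n =
        real (Suc q) * ((-1) ^ p * real (q choose p) * real (Suc q - p) ^ n)"
        by (metis (no_types, opaque_lifting) mult.assoc mult.commute power_Suc)
    qed
    also have "\<dots> = real (Suc q) *
        (\<Sum>p\<le>Suc q. (-1) ^ p * real (q choose p) * real (Suc q - p) ^ n)"
      by (simp only: sum_distrib_left)
    also have "(\<Sum>p\<le>Suc q. (-1) ^ p * real (q choose p) * real (Suc q - p) ^ n) =
        f n (Suc q) + f n q"
      unfolding f_def split
      by (simp add: sum.distrib[symmetric] algebra_simps)
    finally show ?thesis .
  qed
  have f0: "f n 0 = 0 ^ n" for n
    by (simp add: f_def)
  have base: "f 0 (Suc q) = 0" for q
    using choose_alternating_sum[of "Suc q", where ?'a = real] by (simp add: f_def)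
  have "f n q = fact q * real (Stirling n q)"
  proof (induction n q rule: Stirling.induct)
    case (4 n k)
    then show ?case by (simp add: rec algebra_simps)
  qed (simp_all add: f0 base)
  then show ?thesis by (simp add: f_def atLeast0AtMost)
qed

definition max_stage :: "nat \<Rightarrow> nat \<Rightarrow> nat"
  where "max_stage M dmax = min (M - 1) dmax - 1"

text \<open>
  Natural-number subtraction is exact below: only \<open>i \<le> M - 1\<close> occurs.
\<close>

definition num_visits :: "nat \<Rightarrow> nat \<Rightarrow> nat \<Rightarrow> real"
  where "num_visits M d i = fact (M - 1) / fact (M - i - 1) * real (Stirling (d + 1) (i + 1))"

text \<open>
  The unknowns of the traffic equations. The fields \<open>alphaPs\<close> and \<open>alphaNs\<close> are the rates of the
  negative signals \<open>s\<^sub>i\<^sup>-\<close> at \<open>P\<close> and the positive signals \<open>s\<^sub>i\<^sup>+\<close> at \<open>N\<close>. Only the entries in the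
  index ranges mentioned in the traffic equations are meaningful.
\<close>

record rates =
  lam :: real
  alpha :: "nat \<Rightarrow> real"
  Rk :: "nat \<Rightarrow> real"
  alphaPc :: real
  alphaPs :: "nat \<Rightarrow> real"
  alphaNs :: "nat \<Rightarrow> real"
  rhoP :: real
  rhoNc :: real
  rhoNs :: real

definition traffic_equations ::
  "nat \<Rightarrow> nat \<Rightarrow> nat \<Rightarrow> real \<Rightarrow> real \<Rightarrow> real \<Rightarrow> nat pmf \<Rightarrow> rates \<Rightarrow> bool"
  where "traffic_equations M b dmax muP muNc muNs D s \<longleftrightarrow>
    (let U = max_stage M dmax in
      lam s > 0 \<and>
      (\<forall>k\<in>{0..U}. alpha s k \<ge> 0) \<and> alpha s (U + 1) = 0 \<and>
      alphaPc s > 0 \<and>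
      (\<forall>i\<in>{1..b - 1}. alphaPs s i > 0) \<and>
      (\<forall>i\<in>{1..b}. alphaNs s i > 0) \<and>
      rhoP s > 0 \<and> rhoNc s > 0 \<and> rhoNs s > 0 \<and>
      (\<forall>k\<in>{0..U}. alpha s k =
         lam s * of_bool (k = 0) + (real M - 1) * Rk s k + alpha s (k + 1)) \<and>
      (\<forall>k\<in>{0..U}. Rk s k =
         rhoNs s * muNs / (real M - 1) *
         (\<Sum>d = k + 1..dmax.
            lam s * pmf D d / (\<Sum>j = 0..U. alpha s j) * (num_visits M d (k + 1) / real M ^ d))) \<and>
      alphaPc s = rhoNc s * muNc \<and>
      (\<forall>i\<in>{1..b - 1}. alphaPs s i = alphaNs s (i + 1)) \<and>
      alphaNs s b = rhoP s * muP \<and>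
      (\<forall>i\<in>{1..b - 1}. alphaNs s i = rhoP s * alphaPs s i) \<and>
      rhoP s = alphaPc s / (muP + (\<Sum>i = 1..b - 1. alphaPs s i)) \<and>
      rhoNc s = (\<Sum>k = 0..U. alpha s k) / muNc \<and>
      rhoNs s = (\<Sum>i = 1..b. alphaNs s i) / muNs)"

definition lambda_max ::
  "nat \<Rightarrow> nat \<Rightarrow> nat \<Rightarrow> real \<Rightarrow> real \<Rightarrow> real \<Rightarrow> nat pmf \<Rightarrow> real"
  where "lambda_max M b dmax muP muNc muNs D =
    (THE l. \<exists>s. traffic_equations M b dmax muP muNc muNs D s \<and> rhoP s = 1 \<and> lam s = l)"

end

theory Submission
  imports Defs
begin

text \<open>
  The queue equations force geometric signal rates, so the class c load and the class s load of a
  network queue coincide. This cancels the factor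
  \<open>\<rho>\<^sub>N\<^sub>s \<mu>\<^sub>N\<^sub>s / (\<Sum>\<^sub>j \<alpha>\<^sub>j)\<close>, and the stage equations become linear:
  \<open>\<alpha>\<^sub>k = \<lambda> (\<delta>[k] + c\<^sub>k) + \<alpha>\<^sub>k\<^sub>+\<^sub>1\<close>, where \<open>c\<^sub>k\<close> is
  the sum \<open>\<Sum>\<^sub>d D[d] N(M,d,k+1) / M^d\<close>. Summing over the stages gives
  \<open>\<lambda> (1 + \<Sum>\<^sub>k (k + 1) c\<^sub>k)\<close>, which equals the geometric load. As \<open>M\<close> grows, only the term
  \<open>d = k + 1\<close> of \<open>c\<^sub>k\<close> survives.
\<close>

section \<open>Stage weights and their product form\<close>

definition stage_weight :: "nat \<Rightarrow> nat \<Rightarrow> nat pmf \<Rightarrow> nat \<Rightarrow> real"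
  where "stage_weight M dmax D k =
    (\<Sum>d = k + 1..dmax. pmf D d * (num_visits M d (k + 1) / real M ^ d))"

text \<open>Each step of \<open>m\<close> peels the factor \<open>n - m\<close> off the lower
  factorial. The factors are written \<open>n + 1 - z\<close> so that \<open>n = M - 1\<close>
  yields \<open>M - z\<close>.\<close>

lemma fact_quotient_eq_prod:
  "fact n / fact (n - m) = (\<Prod>z = 1..m. real (n + 1) - real z)" if "m \<le> n"
  using that
proof (induction m)
  case (Suc m)
  have "n - m = Suc (n - Suc m)"
    using Suc.prems by simp
  then have "(fact (n - m) :: real) = (real n - real m) * fact (n - Suc m)"
    using Suc.prems by (simp add: of_nat_diff)
  moreover have "real n - real m \<noteq> 0"
    using Suc.prems by simp
  ultimately have "fact n / fact (n - Suc m) = fact n / fact (n - m) * (real n - real m)"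
    by simp
  then show ?case
    using Suc by simp
qed simp

lemma num_visits_eq_prod:
  assumes "i + 1 \<le> M"
  shows "num_visits M d i = (\<Prod>z = 1..i. real M - real z) * real (Stirling (d + 1) (i + 1))"
proof -
  have "M - i - 1 = M - 1 - i"
    by simp
  then show ?thesis
    using assms fact_quotient_eq_prod[of i "M - 1"] by (simp add: num_visits_def)
qed

lemma num_visits_nonneg: "num_visits M d i \<ge> 0"
  by (simp add: num_visits_def)

lemma stage_weight_nonneg: "stage_weight M dmax D k \<ge> 0"
  unfolding stage_weight_def
  by (intro sum_nonneg mult_nonneg_nonneg divide_nonneg_nonneg num_visits_nonneg) simp_all

lemma stage_weight_eq_prod:
  assumes "k + 2 \<le> M"
  shows "stage_weight M dmax D k =
    (\<Sum>d = k + 1..dmax. real (Stirling (d + 1) (k + 2)) * pmf D d *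
      ((\<Prod>z = 1..k + 1. real M - real z) / real M ^ d))"
  unfolding stage_weight_def
  using assms by (intro sum.cong[OF refl]) (simp add: num_visits_eq_prod)

text \<open>The cap \<open>M - 1\<close> in \<open>max_stage\<close> keeps the truncated subtraction
  in \<open>num_visits\<close> exact at \<open>i = k + 1\<close>.\<close>

lemma max_stage_le: "k \<le> max_stage M dmax \<Longrightarrow> M \<ge> 2 \<Longrightarrow> k + 2 \<le> M"
  by (auto simp: max_stage_def)

section \<open>Stage recursion and geometric signal rates\<close>

lemma sum_eq_weighted_sum_differences:
  fixes a g :: "nat \<Rightarrow> real"
  assumes "\<And>k. k \<le> n \<Longrightarrow> a k = g k + a (k + 1)"
  shows "(\<Sum>k = 0..n. a k) = (\<Sum>k = 0..n. real (k + 1) * g k) + real (n + 1) * a (n + 1)"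
  \<comment> \<open>Stage \<open>k\<close> collects the increments of all later stages, so
    \<open>g k\<close> is counted once in each of the stages 0 to \<open>k\<close>. The boundary
    term keeps the induction free of a condition on \<open>a (n + 1)\<close>.\<close>
  using assms
proof (induction n)
  case (Suc n)
  have "a (n + 1) = g (n + 1) + a (n + 2)"
    using Suc.prems[of "Suc n"] by simp
  with Suc show ?case
    by (simp add: algebra_simps)
qed simp

text \<open>Only the rate at \<open>b\<close> is given outright; each step down passes through
  \<open>aP\<close> and gains one factor \<open>r\<close>, hence the downward induction.\<close>

lemma signal_rates_geometric:
  assumes "\<forall>i\<in>{1..b - 1}. aP i = aN (i + 1)" and "aN b = r * mu"
    and "\<forall>i\<in>{1..b - 1}. aN i = r * aP i" and "1 \<le> i" and "i \<le> b"
  shows "aN i = r ^ (b + 1 - i) * (mu :: real)"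
  using \<open>i \<le> b\<close> \<open>1 \<le> i\<close>
proof (induction rule: inc_induct)
  case (step n)
  then have "aN n = r * aN (n + 1)"
    using assms(1,3) by simp
  moreover have "b + 1 - n = Suc (b + 1 - Suc n)"
    using step by simp
  ultimately show ?case
    using step by simp
qed (use assms(2) in simp)

text \<open>Reversing the index leaves \<open>r\<close> times a standard geometric sum; its
  exceptional ratio 1 is the source of the case split in the throughput.\<close>

lemma sum_geometric_shifted:
  "(\<Sum>i = 1..b. r ^ (b + 1 - i)) =
    (if r = 1 then real b else r * (1 - r ^ b) / (1 - r))"
proof -
  have "(\<Sum>i = 1..b. r ^ (b + 1 - i)) = (\<Sum>i<b. r ^ Suc i)"
    by (rule sum.reindex_bij_witness[of _ "\<lambda>i. b - i" "\<lambda>i. b - i"]) (auto simp: Suc_diff_le)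
  also have "\<dots> = r * (\<Sum>i<b. r ^ i)"
    by (simp add: sum_distrib_left)
  also have "\<dots> = (if r = 1 then real b else r * (1 - r ^ b) / (1 - r))"
    by (simp add: sum_gp_strict)
  finally show ?thesis .
qed

section \<open>Throughput formula\<close>

lemma throughput_formula:
  assumes "b \<ge> 1" "muP > 0" "M \<ge> 2" "muNc > 0" "muNs > 0"
    and eqs: "traffic_equations M b dmax muP muNc muNs D s"
  shows "lam s = (if rhoP s = 1 then real b else rhoP s * (1 - rhoP s ^ b) / (1 - rhoP s)) *
    (muP / (1 + (\<Sum>k = 0..max_stage M dmax. real (k + 1) * stage_weight M dmax D k)))"
proof -
  define U where "U = max_stage M dmax"
  define A where "A = (\<Sum>j = 0..U. alpha s j)"
  define r where "r = rhoP s"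
  define W where "W = (\<Sum>k = 0..U. real (k + 1) * stage_weight M dmax D k)"
  have last: "alpha s (U + 1) = 0" and r_pos: "r > 0"
    and alpha_rec: "\<And>k. k \<in> {0..U} \<Longrightarrow>
       alpha s k = lam s * of_bool (k = 0) + (real M - 1) * Rk s k + alpha s (k + 1)"
    and R_eq: "\<And>k. k \<in> {0..U} \<Longrightarrow> Rk s k = rhoNs s * muNs / (real M - 1) *
         (\<Sum>d = k + 1..dmax. lam s * pmf D d / A * (num_visits M d (k + 1) / real M ^ d))"
    and Pc: "alphaPc s = rhoNc s * muNc"
    and Ps: "\<forall>i\<in>{1..b - 1}. alphaPs s i = alphaNs s (i + 1)"
    and Ns_b: "alphaNs s b = r * muP"
    and Ns: "\<forall>i\<in>{1..b - 1}. alphaNs s i = r * alphaPs s i"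
    and Ps_pos: "\<forall>i\<in>{1..b - 1}. alphaPs s i > 0"
    and rP: "r = alphaPc s / (muP + (\<Sum>i = 1..b - 1. alphaPs s i))"
    and rNc: "rhoNc s = A / muNc" and rNs: "rhoNs s = (\<Sum>i = 1..b. alphaNs s i) / muNs"
    and Ns_pos: "\<forall>i\<in>{1..b}. alphaNs s i > 0"
    using eqs
    unfolding traffic_equations_def Let_def U_def[symmetric] A_def[symmetric] r_def[symmetric]
    by blast+
  define S where "S = (\<Sum>i = 1..b. alphaNs s i)"
  \<comment> \<open>Positivity allows the denominator of \<open>rhoP\<close> to be cleared. Then
    \<open>r * muP\<close> is the rate of the last positive signal and each
    \<open>r * alphaPs s i\<close> that of signal \<open>i\<close>, so the class c load
    \<open>A\<close> is the sum \<open>S\<close> of the class s rates.\<close>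
  have "muP + (\<Sum>i = 1..b - 1. alphaPs s i) > 0"
    using Ps_pos \<open>muP > 0\<close> by (intro add_pos_nonneg sum_nonneg) (auto intro: less_imp_le)
  then have "A = r * (muP + (\<Sum>i = 1..b - 1. alphaPs s i))"
    using rP Pc rNc \<open>muNc > 0\<close> by (simp add: field_simps)
  also have "\<dots> = alphaNs s b + (\<Sum>i = 1..b - 1. alphaNs s i)"
    using Ns Ns_b by (simp add: distrib_left sum_distrib_left)
  also have "\<dots> = S"
    using \<open>b \<ge> 1\<close> by (cases b) (simp_all add: S_def)
  finally have A_S: "A = S" .
  \<comment> \<open>The rates \<open>alpha\<close> are only known to be nonnegative;
    \<open>A = S > 0\<close> is what permits cancelling \<open>A\<close> in
    \<open>Rk\<close>.\<close>
  have "S > 0"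
    unfolding S_def using Ns_pos \<open>b \<ge> 1\<close> by (intro sum_pos) auto
  have load: "rhoNs s * muNs = A"
    using rNs \<open>muNs > 0\<close> by (simp add: A_S S_def)
  have "(real M - 1) * Rk s k = lam s * stage_weight M dmax D k" if "k \<le> U" for k
  proof -
    have "real M - 1 \<noteq> 0"
      using \<open>M \<ge> 2\<close> by simp
    then have "(real M - 1) * Rk s k =
      A * (\<Sum>d = k + 1..dmax. lam s * pmf D d / A * (num_visits M d (k + 1) / real M ^ d))"
      using R_eq[of k] that load by simp
    also have "\<dots> = lam s * stage_weight M dmax D k"
      unfolding stage_weight_def sum_distrib_left
      using A_S \<open>S > 0\<close> by (intro sum.cong) auto
    finally show ?thesis .
  qed
  then have "A = (\<Sum>k = 0..U. real (k + 1) *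
      (lam s * of_bool (k = 0) + lam s * stage_weight M dmax D k))"
    unfolding A_def
    by (subst sum_eq_weighted_sum_differences[where g = "\<lambda>k. lam s * of_bool (k = 0) + lam s * stage_weight M dmax D k"])
       (use alpha_rec last in auto)
  \<comment> \<open>New transactions enter at stage 0 alone, with weight 1; this is the 1 in
    \<open>1 + W\<close>.\<close>
  also have "\<dots> = (\<Sum>k = 0..U. if k = 0 then lam s else 0) + lam s * W"
    unfolding W_def sum_distrib_left sum.distrib[symmetric]
    by (intro sum.cong) (auto simp: algebra_simps)
  also have "\<dots> = lam s * (1 + W)"
    by (simp add: algebra_simps)
  finally have "lam s * (1 + W) = S"
    using A_S by simp
  moreover have "W \<ge> 0"
    unfolding W_def by (intro sum_nonneg mult_nonneg_nonneg stage_weight_nonneg) simp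
  ultimately have "lam s = S / (1 + W)"
    by (simp add: field_simps)
  moreover have "S = (\<Sum>i = 1..b. r ^ (b + 1 - i)) * muP"
    unfolding S_def sum_distrib_right
    by (intro sum.cong signal_rates_geometric[OF Ps Ns_b Ns]) auto
  ultimately show ?thesis
    unfolding sum_geometric_shifted by (simp add: r_def W_def U_def)
qed

section \<open>The throughput at utilization 1\<close>

lemma critical_solution_exists:
  assumes "b \<ge> 1" "muP > 0" "M \<ge> 2" "muNc > 0" "muNs > 0"
  shows "\<exists>s. traffic_equations M b dmax muP muNc muNs D s \<and> rhoP s = 1"
proof -
  define U where "U = max_stage M dmax"
  define c where "c = stage_weight M dmax D"
  define W where "W = (\<Sum>k = 0..U. real (k + 1) * c k)"
  \<comment> \<open>The value \<open>l\<close> is forced by \<open>throughput_formula\<close> at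
    ratio 1, and \<open>a\<close> is the stage recursion solved from the top. Its default 0 above
    \<open>U\<close> supplies the boundary condition at \<open>U + 1\<close>.\<close>
  define l where "l = real b * muP / (1 + W)"
  define a where "a k = (if k \<le> U then l * (of_bool (k = 0) + (\<Sum>j = k..U. c j)) else 0)" for k
  \<comment> \<open>With ratio 1 the geometric signal rates are all \<open>muP\<close>, so both
    loads equal \<open>b * muP\<close>.\<close>
  define s where "s = \<lparr>lam = l, alpha = a, Rk = (\<lambda>k. l * c k / (real M - 1)),
    alphaPc = real b * muP, alphaPs = (\<lambda>_. muP), alphaNs = (\<lambda>_. muP), rhoP = 1,
    rhoNc = real b * muP / muNc, rhoNs = real b * muP / muNs\<rparr>"
  have b_pos: "b > 0" and pos: "muNc > 0" "muNs > 0" and nonzero: "muNc \<noteq> 0" "muNs \<noteq> 0"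
    using assms by auto
  have c_nonneg: "c k \<ge> 0" for k
    by (simp add: c_def stage_weight_nonneg)
  have W: "W \<ge> 0"
    unfolding W_def by (intro sum_nonneg mult_nonneg_nonneg c_nonneg) simp
  have l_pos: "l > 0"
    using assms W by (simp add: l_def)
  have a_rec: "a k = l * of_bool (k = 0) + l * c k + a (k + 1)" if "k \<le> U" for k
    using that by (cases "k = U") (auto simp: a_def sum.atLeast_Suc_atMost algebra_simps)
  \<comment> \<open>The normalization of \<open>l\<close> makes the stages add up to
    \<open>b * muP\<close>, which cancels in the equation for \<open>Rk\<close>.\<close>
  have "(\<Sum>k = 0..U. a k) = (\<Sum>k = 0..U. real (k + 1) * (l * of_bool (k = 0) + l * c k))"
    by (subst sum_eq_weighted_sum_differences[where g = "\<lambda>k. l * of_bool (k = 0) + l * c k"])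
       (use a_rec in \<open>auto simp: a_def\<close>)
  also have "\<dots> = (\<Sum>k = 0..U. if k = 0 then l else 0) + l * W"
    unfolding W_def sum_distrib_left sum.distrib[symmetric]
    by (intro sum.cong) (auto simp: algebra_simps)
  also have "\<dots> = l * (1 + W)"
    by (simp add: algebra_simps)
  also have "\<dots> = real b * muP"
    using W by (simp add: l_def)
  finally have sum_a: "(\<Sum>k = 0..U. a k) = real b * muP" .
  have R: "l * c k / (real M - 1) = real b * muP / (real M - 1) *
      (\<Sum>d = k + 1..dmax. l * pmf D d / (real b * muP) * (num_visits M d (k + 1) / real M ^ d))" for k
    unfolding c_def stage_weight_def sum_distrib_left sum_divide_distrib
    using assms by (intro sum.cong) auto
  have a_nonneg: "a k \<ge> 0" for k
    using l_pos by (auto simp: a_def intro!: mult_nonneg_nonneg add_nonneg_nonneg sum_nonneg c_nonneg)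
  have Rk_eq: "\<forall>k\<in>{0..U}. l * c k / (real M - 1) = real b * muP / muNs * muNs / (real M - 1) *
      (\<Sum>d = k + 1..dmax. l * pmf D d / (\<Sum>j = 0..U. a j) * (num_visits M d (k + 1) / real M ^ d))"
    using R assms by (simp add: sum_a)
  have a_last: "a (U + 1) = 0"
    by (simp add: a_def)
  have alpha_eq: "\<forall>k\<in>{0..U}.
      a k = l * of_bool (k = 0) + (real M - 1) * (l * c k / (real M - 1)) + a (k + 1)"
    using a_rec assms by simp
  have "real b = 1 + real (b - 1)"
    using \<open>b \<ge> 1\<close> by simp
  then have Pc: "1 = real b * muP / (muP + (\<Sum>i = 1..b - 1. muP))"
    using assms by (simp add: field_simps)
  have "traffic_equations M b dmax muP muNc muNs D s"
    unfolding traffic_equations_def Let_def U_def[symmetric] s_def rates.simps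
    by (intro conjI alpha_eq Rk_eq Pc)
      (simp_all add: l_pos a_nonneg a_last[simplified] sum_a b_pos pos assms(2) nonzero)
  then show ?thesis
    by (intro exI[of _ s]) (simp add: s_def)
qed

text \<open>A definite description needs existence and uniqueness:
  \<open>critical_solution_exists\<close> gives the former, \<open>throughput_formula\<close> the
  latter.\<close>

lemma lambda_max_eq:
  assumes "b \<ge> 1" "muP > 0" "M \<ge> 2" "muNc > 0" "muNs > 0"
  shows "lambda_max M b dmax muP muNc muNs D =
    real b * muP / (1 + (\<Sum>k = 0..max_stage M dmax. real (k + 1) * stage_weight M dmax D k))"
    (is "_ = ?l")
  unfolding lambda_max_def
proof (rule the_equality)
  have formula: "lam s = ?l"
    if "traffic_equations M b dmax muP muNc muNs D s" "rhoP s = 1" for s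
    using throughput_formula[OF assms that(1)] that(2) by simp
  then show "\<exists>s. traffic_equations M b dmax muP muNc muNs D s \<and> rhoP s = 1 \<and> lam s = ?l"
    using critical_solution_exists[OF assms] by blast
  show "l = ?l"
    if "\<exists>s. traffic_equations M b dmax muP muNc muNs D s \<and> rhoP s = 1 \<and> lam s = l" for l
    using that formula by blast
qed

section \<open>Limit for many shards\<close>

lemma falling_prod_over_power_tendsto:
  assumes "m \<le> d"
  shows "(\<lambda>M. (\<Prod>z = 1..m. real M - real z) / real M ^ d) \<longlonglongrightarrow> of_bool (d = m)"
proof -
  have inv: "(\<lambda>M. 1 / real M) \<longlonglongrightarrow> 0"
    by (rule lim_1_over_n)
  \<comment> \<open>Dividing each of the \<open>m\<close> factors by \<open>M\<close> leaves
    \<open>d - m\<close> powers of \<open>1 / M\<close>: they vanish in the limit if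
    \<open>d > m\<close>, and \<open>0 ^ 0 = 1\<close> covers \<open>d = m\<close>.\<close>
  have "(\<lambda>M. (\<Prod>z = 1..m. 1 - real z * (1 / real M)) * (1 / real M) ^ (d - m))
      \<longlonglongrightarrow> (\<Prod>z = 1..m. 1 - real z * 0) * 0 ^ (d - m)"
    by (intro tendsto_intros inv)
  moreover have "\<forall>\<^sub>F M in sequentially.
      (\<Prod>z = 1..m. 1 - real z * (1 / real M)) * (1 / real M) ^ (d - m) =
      (\<Prod>z = 1..m. real M - real z) / real M ^ d"
    using eventually_gt_at_top[of 0]
  proof eventually_elim
    case (elim M)
    have "(\<Prod>z = 1..m. 1 - real z * (1 / real M)) = (\<Prod>z = 1..m. (real M - real z) / real M)"
      using elim by (intro prod.cong) (auto simp: field_simps)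
    also have "\<dots> = (\<Prod>z = 1..m. real M - real z) / real M ^ m"
      by (simp add: prod_dividef)
    moreover have "real M ^ d = real M ^ m * real M ^ (d - m)"
      using assms by (simp flip: power_add)
    ultimately show ?case
      by (simp add: power_one_over)
  qed
  ultimately have "(\<lambda>M. (\<Prod>z = 1..m. real M - real z) / real M ^ d)
      \<longlonglongrightarrow> (\<Prod>z = 1..m. 1 - real z * 0) * 0 ^ (d - m)"
    by (rule Lim_transform_eventually)
  then show ?thesis
    using assms by (cases "d = m") (simp_all add: power_0_left)
qed

lemma stage_weight_tendsto:
  assumes "k + 1 \<le> dmax"
  shows "(\<lambda>M. stage_weight M dmax D k) \<longlonglongrightarrow> pmf D (k + 1)"
proof -
  have "(\<lambda>M. \<Sum>d = k + 1..dmax. real (Stirling (d + 1) (k + 2)) * pmf D d *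
        ((\<Prod>z = 1..k + 1. real M - real z) / real M ^ d))
      \<longlonglongrightarrow> (\<Sum>d = k + 1..dmax. real (Stirling (d + 1) (k + 2)) * pmf D d * of_bool (d = k + 1))"
    by (intro tendsto_sum tendsto_mult_left falling_prod_over_power_tendsto) simp
  \<comment> \<open>The surviving term has the diagonal coefficient
    \<open>Stirling (k + 2) (k + 2) = 1\<close>.\<close>
  moreover have "(\<Sum>d = k + 1..dmax. real (Stirling (d + 1) (k + 2)) * pmf D d * of_bool (d = k + 1))
      = (\<Sum>d = k + 1..dmax. if d = k + 1 then pmf D d else 0)"
    by (intro sum.cong) auto
  moreover have "\<dots> = pmf D (k + 1)"
    using assms by simp
  moreover have "\<forall>\<^sub>F M in sequentially.
      (\<Sum>d = k + 1..dmax. real (Stirling (d + 1) (k + 2)) * pmf D d *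
        ((\<Prod>z = 1..k + 1. real M - real z) / real M ^ d)) = stage_weight M dmax D k"
    using eventually_ge_at_top[of "k + 2"] by eventually_elim (rule stage_weight_eq_prod[symmetric])
  ultimately show ?thesis
    using Lim_transform_eventually by fastforce
qed

text \<open>The network service rates may vary with \<open>M\<close>, since the closed form of
  \<open>lambda_max\<close> does not contain them.\<close>

lemma lambda_max_tendsto:
  assumes "b \<ge> 1" "dmax \<ge> 1" "muP > 0" and mu: "\<And>M. muNc M > 0 \<and> muNs M > 0"
  shows "(\<lambda>M. lambda_max M b dmax muP (muNc M) (muNs M) D)
    \<longlonglongrightarrow> real b * muP / (1 + (\<Sum>d = 1..dmax. real d * pmf D d))"
proof -
  have mean: "(\<Sum>k = 0..dmax - 1. real (k + 1) * pmf D (k + 1)) = (\<Sum>d = 1..dmax. real d * pmf D d)"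
    using \<open>dmax \<ge> 1\<close> sum.shift_bounds_cl_Suc_ivl[of "\<lambda>d. real d * pmf D d" 0 "dmax - 1"] by simp
  have mean_nonneg: "(\<Sum>d = 1..dmax. real d * pmf D d) \<ge> 0"
    by (intro sum_nonneg) simp
  have "(\<lambda>M. real b * muP /
        (1 + (\<Sum>k = 0..dmax - 1. real (k + 1) * stage_weight M dmax D k)))
      \<longlonglongrightarrow> real b * muP / (1 + (\<Sum>k = 0..dmax - 1. real (k + 1) * pmf D (k + 1)))"
    using \<open>dmax \<ge> 1\<close> mean mean_nonneg
    by (intro tendsto_divide tendsto_const tendsto_add tendsto_sum tendsto_mult_left
        stage_weight_tendsto) auto
  \<comment> \<open>Once \<open>M - 1\<close> exceeds \<open>dmax\<close>, the top stage is
    \<open>dmax - 1\<close>; the range of summation is then fixed and the limit can be taken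
    termwise.\<close>
  moreover have "\<forall>\<^sub>F M in sequentially.
      real b * muP / (1 + (\<Sum>k = 0..dmax - 1. real (k + 1) * stage_weight M dmax D k)) =
      lambda_max M b dmax muP (muNc M) (muNs M) D"
    using eventually_ge_at_top[of "dmax + 2"]
  proof eventually_elim
    case (elim M)
    then have "max_stage M dmax = dmax - 1"
      by (simp add: max_stage_def)
    then show ?case
      using elim assms by (simp add: lambda_max_eq)
  qed
  ultimately show ?thesis
    unfolding mean by (rule Lim_transform_eventually)
qed

theorem mainTheorem2:
  fixes b dmax :: nat and muP :: real and D :: "nat pmf"
  assumes "b \<ge> 1" and "dmax \<ge> 1" and "muP > 0" and "set_pmf D \<subseteq> {1..dmax}"
  shows
    "(\<forall>(M::nat) (muNc::real) (muNs::real) s.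
        M \<ge> 2 \<and> muNc > 0 \<and> muNs > 0 \<and> traffic_equations M b dmax muP muNc muNs D s \<longrightarrow>
        lam s =
          (if rhoP s = 1 then real b else rhoP s * (1 - rhoP s ^ b) / (1 - rhoP s)) *
          (muP /
            (1 + (\<Sum>k = 0..max_stage M dmax. real (k + 1) *
               (\<Sum>d = k + 1..dmax. real (Stirling (d + 1) (k + 2)) * pmf D d *
                  ((\<Prod>z = 1..k + 1. real M - real z) / real M ^ d))))))
     \<and>
     (\<forall>muNc muNs :: nat \<Rightarrow> real.
        (\<forall>M. muNc M > 0 \<and> muNs M > 0) \<longrightarrow>
        (\<lambda>M. lambda_max M b dmax muP (muNc M) (muNs M) D)
          \<longlonglongrightarrow> real b * muP / (1 + (\<Sum>d = 1..dmax. real d * pmf D d)))"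
proof (intro conjI allI impI)
  fix M :: nat and muNc muNs :: real and s :: rates
  assume *: "M \<ge> 2 \<and> muNc > 0 \<and> muNs > 0 \<and> traffic_equations M b dmax muP muNc muNs D s"
  have "(\<Sum>k = 0..max_stage M dmax. real (k + 1) * stage_weight M dmax D k) =
    (\<Sum>k = 0..max_stage M dmax. real (k + 1) *
       (\<Sum>d = k + 1..dmax. real (Stirling (d + 1) (k + 2)) * pmf D d *
          ((\<Prod>z = 1..k + 1. real M - real z) / real M ^ d)))"
    using * by (intro sum.cong[OF refl] arg_cong2[where f = "(*)"] stage_weight_eq_prod)
      (auto dest: max_stage_le)
  then show "lam s =
      (if rhoP s = 1 then real b else rhoP s * (1 - rhoP s ^ b) / (1 - rhoP s)) *
      (muP /
        (1 + (\<Sum>k = 0..max_stage M dmax. real (k + 1) *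
           (\<Sum>d = k + 1..dmax. real (Stirling (d + 1) (k + 2)) * pmf D d *
              ((\<Prod>z = 1..k + 1. real M - real z) / real M ^ d)))))"
    using throughput_formula[of b muP M muNc muNs dmax D s] * assms by metis
next
  fix muNc muNs :: "nat \<Rightarrow> real"
  assume "\<forall>M. muNc M > 0 \<and> muNs M > 0"
  then show "(\<lambda>M. lambda_max M b dmax muP (muNc M) (muNs M) D)
      \<longlonglongrightarrow> real b * muP / (1 + (\<Sum>d = 1..dmax. real d * pmf D d))"
    using assms by (intro lambda_max_tendsto) auto
qed

end
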